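(* Let $\zeta\ge 2$ and let $f\in C_\zeta[0,\infty)\cap H$. Then for every $b>\frac12$, $$\lim_{n\to\infty}K_n^{\ast}(f;x)=f(x)$$ uniformly in $x\in[\frac12,b)$.
   Context: Fix real numbers $\mu\ge 0$, $\alpha\ge 0$, $\beta\ge 0$. Let $\theta_k=0$ for even integers $k\ge 0$ and $\theta_k=1$ for odd $k$. For integers $k\ge 0$ set $$\gamma_\mu(2k)=\frac{2^{2k}k!\,\Gamma(k+\mu+\frac12)}{\Gamma(\mu+\frac12)},\qquad \gamma_\mu(2k+1)=\frac{2^{2k+1}k!\,\Gamma(k+\mu+\frac32)}{\Gamma(\mu+\frac12)},$$ so that $\gamma_\mu(k+1)=(k+1+2\mu\theta_{k+1})\gamma_\mu(k)$, and let $e_\mu(x)=\sum_{k=0}^\infty \frac{x^k}{\gamma_\mu(k)}$. For $n\in\mathbb{N}=\{1,2,\dots\}$ and $x\ge\frac12$ let $r_n(x)=x-\frac1{2n}$ and define $$K_n^{\ast}(f;x)=\frac{n}{e_\mu(nr_n(x))}\sum_{k=0}^\infty\frac{(nr_n(x))^k}{\gamma_\mu(k)}\int_{\frac{k+2\mu\theta_k}{n}}^{\frac{k+1+2\mu\theta_k}{n}}f\left(\frac{nt+\alpha}{n+\beta}\right)\,dt .$$ $C[0,\infty)$ is the space of continuous real-valued functions on $[0,\infty)$; $C_\zeta[0,\infty)=\{f\in C[0,\infty): |f(t)|\le M(1+t)^\zeta \text{ for all } t\ge 0, \text{ for some } M>0\}$; $H$ is the set of functions $f$ on $[0,\infty)$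 such that $\frac{f(x)}{1+x^2}$ converges to a finite limit as $x\to\infty$. *)

theory Defs
  imports "HOL-Analysis.Analysis"
begin

definition dunkl_theta :: "nat \<Rightarrow> real" where
  "dunkl_theta k = (if even k then 0 else 1)"

text \<open>For odd indices \<open>2k + 1\<close>, the integer division \<open>(2k + 1) div 2\<close> recovers \<open>k\<close>.\<close>

definition dunkl_gamma :: "real \<Rightarrow> nat \<Rightarrow> real" where
  "dunkl_gamma \<mu> m =
     (let k = m div 2 in
      if even m
      then 2 ^ (2 * k) * fact k * Gamma (real k + \<mu> + 1 / 2) / Gamma (\<mu> + 1 / 2)
      else 2 ^ (2 * k + 1) * fact k * Gamma (real k + \<mu> + 3 / 2) / Gamma (\<mu> + 1 / 2))"

definition dunkl_exp :: "real \<Rightarrow> real \<Rightarrow> real" where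
  "dunkl_exp \<mu> x = (\<Sum>k. x ^ k / dunkl_gamma \<mu> k)"

definition r_shift :: "nat \<Rightarrow> real \<Rightarrow> real" where
  "r_shift n x = x - 1 / (2 * real n)"

text \<open>The operator \<open>K\<^sub>n\<^sup>*\<close>; it is meant for \<open>n \<ge> 1\<close> and \<open>x \<ge> 1/2\<close>.  Only values of \<open>f\<close> on
  \<open>[0, \<infinity>)\<close> enter, since \<open>\<mu>\<close>, \<open>\<alpha>\<close> and \<open>\<beta>\<close> are nonnegative.\<close>

definition dunkl_kantorovich ::
  "real \<Rightarrow> real \<Rightarrow> real \<Rightarrow> nat \<Rightarrow> (real \<Rightarrow> real) \<Rightarrow> real \<Rightarrow> real" where
  "dunkl_kantorovich \<mu> \<alpha> \<beta> n f x =
     real n / dunkl_exp \<mu> (real n * r_shift n x) *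
     (\<Sum>k. (real n * r_shift n x) ^ k / dunkl_gamma \<mu> k *
        integral {(real k + 2 * \<mu> * dunkl_theta k) / real n ..
                  (real k + 1 + 2 * \<mu> * dunkl_theta k) / real n}
          (\<lambda>t. f ((real n * t + \<alpha>) / (real n + \<beta>))))"

text \<open>Functions on \<open>[0, \<infinity>)\<close> are represented by total functions on the reals whose values at
  negative arguments are irrelevant.\<close>

definition C_growth :: "real \<Rightarrow> (real \<Rightarrow> real) set" where
  "C_growth \<zeta> = {f. continuous_on {0..} f \<and>
     (\<exists>M>0. \<forall>t\<ge>0. \<bar>f t\<bar> \<le> M * (1 + t) powr \<zeta>)}"

definition H_space :: "(real \<Rightarrow> real) set" where
  "H_space = {f. \<exists>L. ((\<lambda>x. f x / (1 + x\<^sup>2)) \<longlongrightarrow> L) at_top}"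

end

theory Submission
  imports Defs
begin

text \<open>
  The operator averages \<open>f\<close> against a probability law: with \<open>y = n * r_shift n x\<close>, the weights
  \<open>y\<^sup>k / \<gamma>\<^sub>\<mu>(k)\<close>, divided by \<open>e\<^sub>\<mu>(y)\<close>, form a Poisson-like distribution on the nodes
  \<open>\<lambda>\<^sub>k = k + 2\<mu>\<theta>\<^sub>k\<close>, and the integral spreads each node over an interval of length \<open>1/n\<close>.

  The recurrence \<open>\<gamma>\<^sub>\<mu>(k+1) = \<lambda>\<^sub>k\<^sub>+\<^sub>1 \<gamma>\<^sub>\<mu>(k)\<close> shifts indices in the sums for the moments, just as
  \<open>k/k! = 1/(k-1)!\<close> does for the Poisson law.  So the mean is exactly \<open>y\<close>, and the variance is at
  most \<open>(1 + 2\<mu>) y\<close> (\<open>dunkl_second_central_moment\<close>).  After rescaling by \<open>1/n\<close> the law is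
  concentrated around \<open>x\<close> with mean square error \<open>O(1/n)\<close>, uniformly for bounded \<open>x\<close>.

  Membership in \<open>H\<close> says that \<open>f\<close> grows at most quadratically.  Together with uniform
  continuity on compact intervals this gives, for every \<open>\<epsilon> > 0\<close>, a constant \<open>C\<close> with
  \<open>\<bar>f s - f x\<bar> \<le> \<epsilon> + C (s - x)\<^sup>2\<close> for all \<open>s \<ge> 0\<close> and all \<open>x\<close> in the bounded interval
  (\<open>quadratic_growth_modulus\<close>).  Averaging this inequality bounds the error by
  \<open>\<epsilon> + O(1/n)\<close>, as in Korovkin's theorem.
\<close>

section \<open>The Dunkl weights and their moments\<close>

definition dunkl_node :: "real \<Rightarrow> nat \<Rightarrow> real" where
  "dunkl_node \<mu> k = real k + 2 * \<mu> * dunkl_theta k"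

definition dunkl_weight :: "real \<Rightarrow> real \<Rightarrow> nat \<Rightarrow> real" where
  "dunkl_weight \<mu> y k = y ^ k / dunkl_gamma \<mu> k"

lemma dunkl_node_0 [simp]: "dunkl_node \<mu> 0 = 0"
  by (simp add: dunkl_node_def dunkl_theta_def)

lemma dunkl_node_ge: "\<mu> \<ge> 0 \<Longrightarrow> real k \<le> dunkl_node \<mu> k"
  by (simp add: dunkl_node_def dunkl_theta_def)

lemma dunkl_node_Suc: "dunkl_node \<mu> (Suc k) = dunkl_node \<mu> k + 1 + 2 * \<mu> * (- 1) ^ k"
  by (simp add: dunkl_node_def dunkl_theta_def)

lemma dunkl_gamma_0:
  assumes "\<mu> \<ge> 0"
  shows "dunkl_gamma \<mu> 0 = 1"
proof -
  have "Gamma (\<mu> + 1 / 2) > 0"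
    using assms by (intro Gamma_real_pos) auto
  then show ?thesis
    by (simp add: dunkl_gamma_def)
qed

lemma dunkl_gamma_Suc:
  assumes "\<mu> \<ge> 0"
  shows "dunkl_gamma \<mu> (Suc k) = dunkl_node \<mu> (Suc k) * dunkl_gamma \<mu> k"
proof (cases "even k")
  case True
  then obtain j where k: "k = 2 * j"
    by blast
  have "Gamma ((real j + \<mu> + 1 / 2) + 1) = (real j + \<mu> + 1 / 2) * Gamma (real j + \<mu> + 1 / 2)"
    using assms by (intro Gamma_plus1) (auto elim!: nonpos_Ints_cases)
  then have G: "Gamma (real j + \<mu> + 3 / 2) = (real j + \<mu> + 1 / 2) * Gamma (real j + \<mu> + 1 / 2)"
    by (simp add: add.assoc)
  show ?thesis
    by (simp add: k dunkl_gamma_def dunkl_node_def dunkl_theta_def G)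
next
  case False
  then obtain j where k: "k = 2 * j + 1"
    by (elim oddE)
  have "real (Suc j) + \<mu> + 1 / 2 = real j + \<mu> + 3 / 2"
    by simp
  then show ?thesis
    by (simp add: k dunkl_gamma_def dunkl_node_def dunkl_theta_def Let_def field_simps)
qed

lemma dunkl_gamma_ge_fact:
  assumes "\<mu> \<ge> 0"
  shows "fact k \<le> dunkl_gamma \<mu> k"
proof (induction k)
  case 0
  then show ?case
    using assms by (simp add: dunkl_gamma_0)
next
  case (Suc k)
  have "real (Suc k) * fact k \<le> dunkl_node \<mu> (Suc k) * dunkl_gamma \<mu> k"
    using dunkl_node_ge[OF assms, of "Suc k"] Suc by (intro mult_mono) auto
  then show ?case
    using assms by (simp add: dunkl_gamma_Suc)
qed

lemma dunkl_gamma_pos: "\<mu> \<ge> 0 \<Longrightarrow> dunkl_gamma \<mu> k > 0"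
  using dunkl_gamma_ge_fact[of \<mu> k] by (meson fact_gt_zero less_le_trans)

lemma dunkl_weight_nonneg: "\<mu> \<ge> 0 \<Longrightarrow> y \<ge> 0 \<Longrightarrow> dunkl_weight \<mu> y k \<ge> 0"
  using dunkl_gamma_pos[of \<mu> k] by (simp add: dunkl_weight_def)

lemma dunkl_weight_sums:
  assumes "\<mu> \<ge> 0" "y \<ge> 0"
  shows "dunkl_weight \<mu> y sums dunkl_exp \<mu> y"
proof -
  have "summable (dunkl_weight \<mu> y)"
  proof (rule summable_comparison_test)
    show "summable (\<lambda>k. inverse (fact k) * y ^ k)"
      by (rule summable_exp)
    show "\<exists>N. \<forall>k\<ge>N. norm (dunkl_weight \<mu> y k) \<le> inverse (fact k) * y ^ k"
    proof (intro exI allI impI)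
      fix k
      have "y ^ k / dunkl_gamma \<mu> k \<le> y ^ k / fact k"
        using assms dunkl_gamma_ge_fact[of \<mu> k] dunkl_gamma_pos[of \<mu> k]
        by (intro divide_left_mono mult_pos_pos) auto
      then have "dunkl_weight \<mu> y k \<le> inverse (fact k) * y ^ k"
        by (simp add: dunkl_weight_def divide_inverse mult.commute)
      then show "norm (dunkl_weight \<mu> y k) \<le> inverse (fact k) * y ^ k"
        using dunkl_weight_nonneg[OF assms, of k] by simp
    qed
  qed
  then show ?thesis
    unfolding dunkl_exp_def dunkl_weight_def by (rule summable_sums)
qed

lemma dunkl_exp_pos:
  assumes "\<mu> \<ge> 0" "y \<ge> 0"
  shows "dunkl_exp \<mu> y > 0"
proof -
  have "sum (dunkl_weight \<mu> y) {0} \<le> dunkl_exp \<mu> y"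
    using dunkl_weight_sums[OF assms] dunkl_weight_nonneg[OF assms]
    by (metis finite.simps sum_le_suminf sums_iff)
  then show ?thesis
    using assms by (simp add: dunkl_weight_def dunkl_gamma_0)
qed

text \<open>The analogue of \<open>k * (y\<^sup>k / k!) = y * (y\<^sup>k\<^sup>-\<^sup>1 / (k-1)!)\<close>, on which all the moment
  computations rest.\<close>

lemma dunkl_weight_shift:
  assumes "\<mu> \<ge> 0"
  shows "dunkl_weight \<mu> y (Suc k) * dunkl_node \<mu> (Suc k) = y * dunkl_weight \<mu> y k"
  using dunkl_gamma_pos[OF assms, of k] dunkl_node_ge[OF assms, of "Suc k"]
  by (simp add: dunkl_weight_def dunkl_gamma_Suc[OF assms] field_simps)

lemma dunkl_first_moment:
  assumes "\<mu> \<ge> 0" "y \<ge> 0"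
  shows "(\<lambda>k. dunkl_weight \<mu> y k * dunkl_node \<mu> k) sums (y * dunkl_exp \<mu> y)"
proof -
  have "(\<lambda>k. dunkl_weight \<mu> y (Suc k) * dunkl_node \<mu> (Suc k)) sums (y * dunkl_exp \<mu> y)"
    unfolding dunkl_weight_shift[OF assms(1)] by (intro sums_mult dunkl_weight_sums assms)
  then show ?thesis
    by (subst (asm) sums_Suc_iff) simp
qed

text \<open>The shift turns the second moment into \<open>y\<close> times the mean of the node that follows.
  Bounding the gap between consecutive nodes by \<open>1 + 2\<mu>\<close> avoids the alternating sum
  \<open>e\<^sub>\<mu>(-y)\<close>, which enters the exact value.\<close>

lemma dunkl_second_moment:
  assumes "\<mu> \<ge> 0" "y \<ge> 0"
  obtains S where "(\<lambda>k. dunkl_weight \<mu> y k * (dunkl_node \<mu> k)\<^sup>2) sums S"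
    and "S \<le> (y\<^sup>2 + (1 + 2 * \<mu>) * y) * dunkl_exp \<mu> y"
proof -
  let ?w = "dunkl_weight \<mu> y" and ?l = "dunkl_node \<mu>"
  let ?u = "\<lambda>k. y * (?w k * ?l k + (1 + 2 * \<mu>) * ?w k)"
  have u: "?u sums (y * (y * dunkl_exp \<mu> y + (1 + 2 * \<mu>) * dunkl_exp \<mu> y))"
    by (intro sums_mult sums_add dunkl_first_moment dunkl_weight_sums assms)
  have eq: "?w (Suc k) * (?l (Suc k))\<^sup>2 = y * (?w k * ?l (Suc k))" for k
    using dunkl_weight_shift[OF assms(1), of y k] by (simp add: power2_eq_square algebra_simps)
  have le: "?w (Suc k) * (?l (Suc k))\<^sup>2 \<le> ?u k" for k
  proof -
    have "?l (Suc k) \<le> ?l k + (1 + 2 * \<mu>)"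
      using assms by (cases "even k") (auto simp: dunkl_node_Suc)
    then have "?w k * ?l (Suc k) \<le> ?w k * (?l k + (1 + 2 * \<mu>))"
      using dunkl_weight_nonneg[OF assms] by (intro mult_left_mono)
    then show ?thesis
      unfolding eq using assms by (intro mult_left_mono) (auto simp: algebra_simps)
  qed
  have nonneg: "0 \<le> ?w (Suc k) * (?l (Suc k))\<^sup>2" for k
    using dunkl_weight_nonneg[OF assms] by simp
  have sm: "summable (\<lambda>k. ?w (Suc k) * (?l (Suc k))\<^sup>2)"
    using le nonneg by (intro summable_comparison_test[OF _ sums_summable[OF u]]) auto
  let ?S = "\<Sum>k. ?w (Suc k) * (?l (Suc k))\<^sup>2"
  have "?S \<le> y * (y * dunkl_exp \<mu> y + (1 + 2 * \<mu>) * dunkl_exp \<mu> y)"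
    using sums_le[OF le summable_sums[OF sm] u] .
  moreover have "(\<lambda>k. ?w k * (?l k)\<^sup>2) sums ?S"
    using summable_sums[OF sm] by (subst (asm) sums_Suc_iff) simp
  ultimately show ?thesis
    by (intro that) (auto simp: power2_eq_square algebra_simps)
qed

lemma dunkl_second_central_moment:
  assumes "\<mu> \<ge> 0" "y \<ge> 0"
  obtains V where "(\<lambda>k. dunkl_weight \<mu> y k * (dunkl_node \<mu> k - y)\<^sup>2) sums V"
    and "V \<le> (1 + 2 * \<mu>) * y * dunkl_exp \<mu> y"
proof -
  obtain S where S: "(\<lambda>k. dunkl_weight \<mu> y k * (dunkl_node \<mu> k)\<^sup>2) sums S"
    "S \<le> (y\<^sup>2 + (1 + 2 * \<mu>) * y) * dunkl_exp \<mu> y"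
    using dunkl_second_moment[OF assms] .
  have "(\<lambda>k. dunkl_weight \<mu> y k * (dunkl_node \<mu> k)\<^sup>2
           - 2 * y * (dunkl_weight \<mu> y k * dunkl_node \<mu> k) + y\<^sup>2 * dunkl_weight \<mu> y k)
        sums (S - 2 * y * (y * dunkl_exp \<mu> y) + y\<^sup>2 * dunkl_exp \<mu> y)"
    by (intro sums_add sums_diff sums_mult S dunkl_first_moment dunkl_weight_sums assms)
  then show ?thesis
    using S(2) by (intro that) (auto simp: power2_eq_square algebra_simps)
qed

text \<open>Averaging a pointwise estimate: errors of the form \<open>A + B * (\<lambda>\<^sub>k - y)\<^sup>2\<close> at the nodes cost at
  most \<open>A\<close> plus \<open>B\<close> times the variance in the mean.\<close>

lemma dunkl_mean_error:
  assumes "\<mu> \<ge> 0" "y \<ge> 0" "B \<ge> 0"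
    and F: "\<And>k. \<bar>F k - v\<bar> \<le> A + B * (dunkl_node \<mu> k - y)\<^sup>2"
  shows "summable (\<lambda>k. dunkl_weight \<mu> y k * F k)"
    and "\<bar>(\<Sum>k. dunkl_weight \<mu> y k * F k) / dunkl_exp \<mu> y - v\<bar> \<le> A + B * ((1 + 2 * \<mu>) * y)"
proof -
  let ?w = "dunkl_weight \<mu> y" and ?e = "dunkl_exp \<mu> y"
  let ?u = "\<lambda>k. A * ?w k + B * (?w k * (dunkl_node \<mu> k - y)\<^sup>2)"
  have e: "?e > 0"
    using dunkl_exp_pos assms by simp
  obtain V where V: "(\<lambda>k. ?w k * (dunkl_node \<mu> k - y)\<^sup>2) sums V" "V \<le> (1 + 2 * \<mu>) * y * ?e"
    using dunkl_second_central_moment[OF assms(1,2)] .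
  have u: "?u sums (A * ?e + B * V)"
    by (intro sums_add sums_mult V dunkl_weight_sums assms)
  have le: "\<bar>?w k * (F k - v)\<bar> \<le> ?u k" for k
  proof -
    have "?w k * \<bar>F k - v\<bar> \<le> ?w k * (A + B * (dunkl_node \<mu> k - y)\<^sup>2)"
      using F dunkl_weight_nonneg[OF assms(1,2)] by (intro mult_left_mono)
    also have "\<dots> = ?u k"
      by (simp add: algebra_simps)
    finally show ?thesis
      using dunkl_weight_nonneg[OF assms(1,2), of k] by (simp add: abs_mult)
  qed
  have sm_abs: "summable (\<lambda>k. \<bar>?w k * (F k - v)\<bar>)"
    using le by (intro summable_comparison_test[OF _ sums_summable[OF u]]) auto
  then have sm: "summable (\<lambda>k. ?w k * (F k - v))"
    by (rule summable_rabs_cancel)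
  have "\<bar>\<Sum>k. ?w k * (F k - v)\<bar> \<le> (\<Sum>k. \<bar>?w k * (F k - v)\<bar>)"
    using sm_abs by (rule summable_rabs)
  also have "\<dots> \<le> A * ?e + B * V"
    using sums_le[OF le summable_sums[OF sm_abs] u] .
  also have "\<dots> \<le> A * ?e + B * ((1 + 2 * \<mu>) * y * ?e)"
    using V assms by (intro add_left_mono mult_left_mono)
  finally have bound: "\<bar>\<Sum>k. ?w k * (F k - v)\<bar> \<le> (A + B * ((1 + 2 * \<mu>) * y)) * ?e"
    by (simp add: algebra_simps)
  have "(\<lambda>k. ?w k * (F k - v) + v * ?w k) sums ((\<Sum>k. ?w k * (F k - v)) + v * ?e)"
    by (intro sums_add sums_mult summable_sums[OF sm] dunkl_weight_sums assms)
  then have F_sums: "(\<lambda>k. ?w k * F k) sums ((\<Sum>k. ?w k * (F k - v)) + v * ?e)"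
    by (simp add: algebra_simps)
  then show "summable (\<lambda>k. ?w k * F k)"
    by (rule sums_summable)
  from F_sums have "(\<Sum>k. ?w k * F k) / ?e - v = (\<Sum>k. ?w k * (F k - v)) / ?e"
    using e by (simp add: sums_iff field_simps)
  then show "\<bar>(\<Sum>k. ?w k * F k) / ?e - v\<bar> \<le> A + B * ((1 + 2 * \<mu>) * y)"
    using bound e by (simp add: abs_divide pos_divide_le_eq)
qed

section \<open>Functions of quadratic growth\<close>

lemma H_space_quadratic_bound:
  assumes "continuous_on {0..} f" "f \<in> H_space"
  obtains M where "M > 0" "\<And>t. t \<ge> 0 \<Longrightarrow> \<bar>f t\<bar> \<le> M * (1 + t\<^sup>2)"
proof -
  obtain L where L: "((\<lambda>x. f x / (1 + x\<^sup>2)) \<longlongrightarrow> L) at_top"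
    using assms(2) by (auto simp: H_space_def)
  have "\<forall>\<^sub>F x in at_top. \<bar>f x / (1 + x\<^sup>2)\<bar> < \<bar>L\<bar> + 1"
    using tendsto_rabs[OF L] by (rule order_tendstoD) simp
  then obtain N where N: "\<And>x. x \<ge> N \<Longrightarrow> \<bar>f x / (1 + x\<^sup>2)\<bar> < \<bar>L\<bar> + 1"
    by (auto simp: eventually_at_top_linorder)
  have "continuous_on {0..N} f"
    using assms(1) by (rule continuous_on_subset) auto
  then have "compact (f ` {0..N})"
    by (intro compact_continuous_image) auto
  then obtain Q where Q: "\<And>x. x \<in> {0..N} \<Longrightarrow> \<bar>f x\<bar> \<le> Q"
    using compact_imp_bounded bounded_iff by (metis imageI real_norm_def)
  show thesis
  proof (rule that[of "\<bar>Q\<bar> + \<bar>L\<bar> + 1"])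
    fix t :: real
    assume t: "t \<ge> 0"
    have pos: "1 + t\<^sup>2 > 0"
      by (simp add: add_pos_nonneg)
    show "\<bar>f t\<bar> \<le> (\<bar>Q\<bar> + \<bar>L\<bar> + 1) * (1 + t\<^sup>2)"
    proof (cases "t \<ge> N")
      case True
      have "\<bar>f t\<bar> \<le> (\<bar>L\<bar> + 1) * (1 + t\<^sup>2)"
        using N[OF True] pos by (simp add: abs_divide field_simps)
      also have "\<dots> \<le> (\<bar>Q\<bar> + \<bar>L\<bar> + 1) * (1 + t\<^sup>2)"
        using pos by (intro mult_right_mono) auto
      finally show ?thesis .
    next
      case False
      have "\<bar>f t\<bar> \<le> (\<bar>Q\<bar> + \<bar>L\<bar> + 1) * 1"
        using Q[of t] False t by simp
      also have "\<dots> \<le> (\<bar>Q\<bar> + \<bar>L\<bar> + 1) * (1 + t\<^sup>2)"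
        by (intro mult_left_mono) auto
      finally show ?thesis .
    qed
  qed auto
qed

text \<open>Near the diagonal, uniform continuity supplies the \<open>\<epsilon>\<close>.  At distance at least \<open>\<delta>\<close> from
  it, constants are at most a multiple of \<open>(s - x)\<^sup>2\<close>, and so is a quadratically growing function,
  because \<open>s\<^sup>2 \<le> 2 (s - x)\<^sup>2 + 2 x\<^sup>2\<close>.\<close>

lemma quadratic_growth_modulus:
  assumes cont: "continuous_on {0..} f"
    and M: "M > 0" "\<And>t. t \<ge> 0 \<Longrightarrow> \<bar>f t\<bar> \<le> M * (1 + t\<^sup>2)"
    and "\<epsilon> > 0"
  obtains C where "C \<ge> 0"
    "\<And>s x :: real. s \<ge> 0 \<Longrightarrow> 0 \<le> x \<Longrightarrow> x \<le> b \<Longrightarrow> \<bar>f s - f x\<bar> \<le> \<epsilon> + C * (s - x)\<^sup>2"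
proof -
  have "continuous_on {0..b + 1} f"
    using cont by (rule continuous_on_subset) auto
  then have "uniformly_continuous_on {0..b + 1} f"
    by (intro compact_uniformly_continuous) auto
  then obtain d where d: "d > 0"
    "\<And>s x. s \<in> {0..b + 1} \<Longrightarrow> x \<in> {0..b + 1} \<Longrightarrow> dist s x < d \<Longrightarrow> dist (f s) (f x) < \<epsilon>"
    using \<open>\<epsilon> > 0\<close> unfolding uniformly_continuous_on_def by metis
  (* The cap at 1 keeps s inside the compact interval whenever it is close to x. *)
  define \<delta> where "\<delta> = min d 1"
  have \<delta>: "\<delta> > 0" "\<delta> \<le> 1" "\<delta> \<le> d"
    using d(1) by (auto simp: \<delta>_def)
  define C where "C = M * ((2 + 3 * b\<^sup>2) / \<delta>\<^sup>2 + 2)"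
  have C: "C \<ge> 0"
    using M(1) \<delta> by (simp add: C_def)
  show thesis
  proof (rule that[OF C])
    fix s x :: real
    assume sx: "s \<ge> 0" "0 \<le> x" "x \<le> b"
    show "\<bar>f s - f x\<bar> \<le> \<epsilon> + C * (s - x)\<^sup>2"
    proof (cases "\<bar>s - x\<bar> < \<delta>")
      case True
      then have "\<bar>f s - f x\<bar> < \<epsilon>"
        using d(2)[of s x] sx \<delta> by (auto simp: dist_real_def)
      moreover have "C * (s - x)\<^sup>2 \<ge> 0"
        using C by simp
      ultimately show ?thesis
        by linarith
    next
      case False
      then have "\<delta>\<^sup>2 \<le> (s - x)\<^sup>2"
        using \<delta>(1) by (intro abs_le_square_iff[THEN iffD1]) auto
      then have far: "1 \<le> (s - x)\<^sup>2 / \<delta>\<^sup>2"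
        using \<delta>(1) by simp
      have "x\<^sup>2 \<le> b\<^sup>2"
        using sx by (intro power_mono) auto
      moreover have "s\<^sup>2 \<le> 2 * (s - x)\<^sup>2 + 2 * x\<^sup>2"
        using zero_le_power2[of "s - 2 * x"] by (simp add: power2_eq_square algebra_simps)
      ultimately have sum: "(1 + s\<^sup>2) + (1 + x\<^sup>2) \<le> (2 + 3 * b\<^sup>2) * 1 + 2 * (s - x)\<^sup>2"
        by argo
      have "\<bar>f s - f x\<bar> \<le> M * ((1 + s\<^sup>2) + (1 + x\<^sup>2))"
        using M(2)[of s] M(2)[of x] sx by (simp add: distrib_left)
      also have "\<dots> \<le> M * ((2 + 3 * b\<^sup>2) * 1 + 2 * (s - x)\<^sup>2)"
        using sum M(1) by (intro mult_left_mono) auto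
      also have "\<dots> \<le> M * ((2 + 3 * b\<^sup>2) * ((s - x)\<^sup>2 / \<delta>\<^sup>2) + 2 * (s - x)\<^sup>2)"
        using far M(1) by (intro mult_left_mono add_right_mono) auto
      also have "\<dots> = C * (s - x)\<^sup>2"
        by (simp add: C_def algebra_simps)
      finally show ?thesis
        using \<open>\<epsilon> > 0\<close> by linarith
    qed
  qed
qed

section \<open>The Kantorovich averages\<close>

text \<open>On the interval attached to the node \<open>\<lambda>\<^sub>k\<close>, the argument of \<open>f\<close> differs from \<open>x\<close> by at most
  \<open>(\<bar>\<lambda>\<^sub>k - y\<bar> + D) / n\<close>, where \<open>D\<close> collects the length of the interval, the half-step in
  \<open>r_shift\<close> and the effect of \<open>\<alpha>\<close> and \<open>\<beta>\<close>.\<close>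

lemma kantorovich_argument_deviation:
  fixes n \<alpha> \<beta> x b l t :: real
  assumes "n > 0" "\<alpha> \<ge> 0" "\<beta> \<ge> 0" "0 \<le> x" "x \<le> b" "l / n \<le> t" "t \<le> (l + 1) / n"
  shows "((n * t + \<alpha>) / (n + \<beta>) - x)\<^sup>2
           \<le> 2 / n\<^sup>2 * ((l - (n * x - 1 / 2))\<^sup>2 + (1 / 2 + \<alpha> + \<beta> * b)\<^sup>2)"
proof -
  define a where "a = l - (n * x - 1 / 2)"
  define c where "c = n * t - l - 1 / 2 + \<alpha> - \<beta> * x"
  define D where "D = 1 / 2 + \<alpha> + \<beta> * b"
  have "0 \<le> n * t - l" "n * t - l \<le> 1"
    using assms by (auto simp: field_simps)
  moreover have "0 \<le> \<beta> * x" "\<beta> * x \<le> \<beta> * b"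
    using assms by (auto intro: mult_left_mono)
  ultimately have "\<bar>c\<bar> \<le> \<bar>D\<bar>"
    using assms(2) by (simp add: c_def D_def abs_le_iff)
  then have "c\<^sup>2 \<le> D\<^sup>2"
    by (simp add: abs_le_square_iff)
  moreover have "(a + c)\<^sup>2 \<le> 2 * a\<^sup>2 + 2 * c\<^sup>2"
    using zero_le_power2[of "a - c"] by (simp add: power2_eq_square algebra_simps)
  ultimately have ac: "(a + c)\<^sup>2 \<le> 2 * (a\<^sup>2 + D\<^sup>2)"
    by argo
  have "(n * t + \<alpha>) / (n + \<beta>) - x = (a + c) / (n + \<beta>)"
    using assms by (simp add: a_def c_def field_simps)
  then have "((n * t + \<alpha>) / (n + \<beta>) - x)\<^sup>2 = (a + c)\<^sup>2 / (n + \<beta>)\<^sup>2"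
    by (simp add: power_divide)
  also have "\<dots> \<le> (a + c)\<^sup>2 / n\<^sup>2"
    using assms by (intro divide_left_mono power_mono mult_pos_pos) auto
  also have "\<dots> \<le> 2 * (a\<^sup>2 + D\<^sup>2) / n\<^sup>2"
    using ac by (rule divide_right_mono) simp
  finally show ?thesis
    by (simp add: a_def D_def)
qed

lemma kantorovich_average_error:
  fixes n \<alpha> \<beta> x b l C \<epsilon> :: real
  assumes "n > 0" "\<alpha> \<ge> 0" "\<beta> \<ge> 0" "0 \<le> x" "x \<le> b" "l \<ge> 0" "C \<ge> 0"
    and cont: "continuous_on {0..} f"
    and f: "\<And>s. s \<ge> 0 \<Longrightarrow> \<bar>f s - f x\<bar> \<le> \<epsilon> + C * (s - x)\<^sup>2"
  shows "\<bar>n * integral {l / n..(l + 1) / n} (\<lambda>t. f ((n * t + \<alpha>) / (n + \<beta>))) - f x\<bar>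
           \<le> (\<epsilon> + 2 * C / n\<^sup>2 * (1 / 2 + \<alpha> + \<beta> * b)\<^sup>2)
             + 2 * C / n\<^sup>2 * (l - (n * x - 1 / 2))\<^sup>2"
proof -
  define I where "I = {l / n..(l + 1) / n}"
  define g where "g = (\<lambda>t. f ((n * t + \<alpha>) / (n + \<beta>)))"
  define E where "E = (\<epsilon> + 2 * C / n\<^sup>2 * (1 / 2 + \<alpha> + \<beta> * b)\<^sup>2)
             + 2 * C / n\<^sup>2 * (l - (n * x - 1 / 2))\<^sup>2"
  have len: "(l + 1) / n - l / n = 1 / n" "l / n \<le> (l + 1) / n"
    using assms(1) by (auto simp: field_simps)
  have pos: "(n * t + \<alpha>) / (n + \<beta>) \<ge> 0" if "t \<in> I" for t
  proof -
    have "l / n \<ge> 0"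
      using assms by simp
    then have "t \<ge> 0"
      using that by (auto simp: I_def)
    then show ?thesis
      using assms by simp
  qed
  have dev: "\<bar>g t - f x\<bar> \<le> E" if "t \<in> I" for t
  proof -
    have "\<bar>g t - f x\<bar> \<le> \<epsilon> + C * ((n * t + \<alpha>) / (n + \<beta>) - x)\<^sup>2"
      unfolding g_def using pos[OF that] by (rule f)
    also have "\<dots> \<le> \<epsilon> + C * (2 / n\<^sup>2 * ((l - (n * x - 1 / 2))\<^sup>2 + (1 / 2 + \<alpha> + \<beta> * b)\<^sup>2))"
      using that assms unfolding I_def
      by (intro add_left_mono mult_left_mono kantorovich_argument_deviation) auto
    also have "\<dots> = E"
      by (simp add: E_def algebra_simps add_divide_distrib)
    finally show ?thesis .
  qed
  have "continuous_on I g"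
    unfolding g_def
    using pos assms by (intro continuous_on_compose2[OF cont] continuous_intros) auto
  then have "g integrable_on I"
    unfolding I_def by (rule integrable_continuous_interval)
  then have "(g has_integral integral I g) I"
    by (rule integrable_integral)
  moreover have "((\<lambda>t. f x) has_integral (f x / n)) I"
    using has_integral_const_real[of "f x" "l / n" "(l + 1) / n"] len by (simp add: I_def)
  ultimately have "((\<lambda>t. g t - f x) has_integral (integral I g - f x / n)) I"
    by (rule has_integral_diff)
  then have "norm (integral I g - f x / n) \<le> E * measure lborel I"
    using dev order_trans[OF abs_ge_zero dev, of "l / n"] len(2) unfolding I_def
    by (intro has_integral_bound_real[where f = "\<lambda>t. g t - f x" and S = "{}"]) auto
  also have "measure lborel I = 1 / n"
    using len by (simp add: I_def)
  finally have "n * \<bar>integral I g - f x / n\<bar> \<le> E"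
    using assms(1) by (simp add: field_simps)
  moreover have "n * \<bar>integral I g - f x / n\<bar> = \<bar>n * integral I g - f x\<bar>"
    using assms(1) abs_mult[of n "integral I g - f x / n"] by (simp add: algebra_simps)
  ultimately show ?thesis
    unfolding I_def g_def E_def by simp
qed

lemma dunkl_kantorovich_error:
  assumes "\<mu> \<ge> 0" "\<alpha> \<ge> 0" "\<beta> \<ge> 0" "n \<ge> 1" "1 / 2 \<le> x" "x \<le> b" "C \<ge> 0"
    and cont: "continuous_on {0..} f"
    and f: "\<And>s. s \<ge> 0 \<Longrightarrow> \<bar>f s - f x\<bar> \<le> \<epsilon> + C * (s - x)\<^sup>2"
  shows "\<bar>dunkl_kantorovich \<mu> \<alpha> \<beta> n f x - f x\<bar>
           \<le> \<epsilon> + 2 * C * (1 / 2 + \<alpha> + \<beta> * b)\<^sup>2 / (real n)\<^sup>2 + 2 * C * (1 + 2 * \<mu>) * b / real n"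
proof -
  define y where "y = real n * x - 1 / 2"
  define J where "J = (\<lambda>k. integral {dunkl_node \<mu> k / real n..(dunkl_node \<mu> k + 1) / real n}
          (\<lambda>t. f ((real n * t + \<alpha>) / (real n + \<beta>))))"
  define D where "D = 1 / 2 + \<alpha> + \<beta> * b"
  have n: "real n \<ge> 1"
    using assms(4) by simp
  have shift: "real n * r_shift n x = y"
    using n by (simp add: y_def r_shift_def algebra_simps)
  have "1 * (1 / 2) \<le> real n * x"
    using n assms(5) by (intro mult_mono) auto
  then have y: "y \<ge> 0"
    by (simp add: y_def)
  have err: "\<bar>real n * J k - f x\<bar>
      \<le> (\<epsilon> + 2 * C / (real n)\<^sup>2 * D\<^sup>2) + 2 * C / (real n)\<^sup>2 * (dunkl_node \<mu> k - y)\<^sup>2" for k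
    unfolding J_def y_def D_def
    using n assms dunkl_node_ge[OF assms(1), of k]
    by (intro kantorovich_average_error cont f) auto
  have K: "dunkl_kantorovich \<mu> \<alpha> \<beta> n f x
      = (\<Sum>k. dunkl_weight \<mu> y k * (real n * J k)) / dunkl_exp \<mu> y"
  proof -
    have "dunkl_kantorovich \<mu> \<alpha> \<beta> n f x
        = real n / dunkl_exp \<mu> y * (\<Sum>k. dunkl_weight \<mu> y k * J k)"
      unfolding dunkl_kantorovich_def shift J_def dunkl_weight_def dunkl_node_def
      by (simp add: add_ac)
    moreover have "(\<Sum>k. dunkl_weight \<mu> y k * (real n * J k))
        = real n * (\<Sum>k. dunkl_weight \<mu> y k * J k)"
    proof -
      have "summable (\<lambda>k. dunkl_weight \<mu> y k * (real n * J k))"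
        using assms(1,7) y by (intro dunkl_mean_error(1)[OF _ _ _ err]) auto
      then have "summable (\<lambda>k. real n * (dunkl_weight \<mu> y k * J k))"
        by (simp add: mult.left_commute)
      then have "summable (\<lambda>k. dunkl_weight \<mu> y k * J k)"
        using n by (subst (asm) summable_cmult_iff) auto
      from suminf_mult[OF this, of "real n"] show ?thesis
        by (simp add: mult.left_commute)
    qed
    ultimately show ?thesis
      by simp
  qed
  have "\<bar>dunkl_kantorovich \<mu> \<alpha> \<beta> n f x - f x\<bar>
      \<le> (\<epsilon> + 2 * C / (real n)\<^sup>2 * D\<^sup>2) + 2 * C / (real n)\<^sup>2 * ((1 + 2 * \<mu>) * y)"
    unfolding K using assms(1,7) y err by (intro dunkl_mean_error(2)) auto
  also have "\<dots> \<le> (\<epsilon> + 2 * C / (real n)\<^sup>2 * D\<^sup>2)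
      + 2 * C / (real n)\<^sup>2 * ((1 + 2 * \<mu>) * (real n * b))"
  proof -
    have "real n * x \<le> real n * b"
      using assms(6) by (intro mult_left_mono) auto
    then have "y \<le> real n * b"
      by (simp add: y_def)
    then show ?thesis
      using assms(1,7) by (intro add_left_mono mult_left_mono) auto
  qed
  also have "\<dots> = \<epsilon> + 2 * C * D\<^sup>2 / (real n)\<^sup>2 + 2 * C * (1 + 2 * \<mu>) * b / real n"
    using n by (simp add: power2_eq_square field_simps)
  finally show ?thesis
    by (simp add: D_def)
qed

section \<open>Uniform convergence\<close>

theorem theorem3p1:
  fixes \<mu> \<alpha> \<beta> \<zeta> b :: real and f :: "real \<Rightarrow> real"
  assumes "\<mu> \<ge> 0" and "\<alpha> \<ge> 0" and "\<beta> \<ge> 0"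
    and "\<zeta> \<ge> 2"
    and "f \<in> C_growth \<zeta> \<inter> H_space"
    and "b > 1 / 2"
  shows "uniform_limit {1 / 2..<b} (\<lambda>n x. dunkl_kantorovich \<mu> \<alpha> \<beta> n f x) f sequentially"
proof (rule uniform_limitI)
  fix e :: real
  assume e: "e > 0"
  have cont: "continuous_on {0..} f"
    using assms(5) by (auto simp: C_growth_def)
  obtain M where M: "M > 0" "\<And>t. t \<ge> 0 \<Longrightarrow> \<bar>f t\<bar> \<le> M * (1 + t\<^sup>2)"
    using H_space_quadratic_bound[OF cont] assms(5) by blast
  obtain C where C: "C \<ge> 0"
    "\<And>s x. s \<ge> 0 \<Longrightarrow> 0 \<le> x \<Longrightarrow> x \<le> b \<Longrightarrow> \<bar>f s - f x\<bar> \<le> e / 2 + C * (s - x)\<^sup>2"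
    using quadratic_growth_modulus[OF cont M, of "e / 2" b] e by auto
  define R where "R n = e / 2 + 2 * C * (1 / 2 + \<alpha> + \<beta> * b)\<^sup>2 / (real n)\<^sup>2
      + 2 * C * (1 + 2 * \<mu>) * b / real n" for n :: nat
  have inv: "(\<lambda>n. 1 / real n) \<longlonglongrightarrow> 0"
    by (rule lim_1_over_n)
  have "(\<lambda>n. e / 2 + 2 * C * (1 / 2 + \<alpha> + \<beta> * b)\<^sup>2 * (1 / real n)\<^sup>2
      + 2 * C * (1 + 2 * \<mu>) * b * (1 / real n))
    \<longlonglongrightarrow> e / 2 + 2 * C * (1 / 2 + \<alpha> + \<beta> * b)\<^sup>2 * 0\<^sup>2 + 2 * C * (1 + 2 * \<mu>) * b * 0"
    by (intro tendsto_intros inv)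
  then have "R \<longlonglongrightarrow> e / 2"
    by (simp add: R_def[abs_def] power_divide)
  then have "\<forall>\<^sub>F n in sequentially. R n < e"
    by (rule order_tendstoD(2)) (use e in simp)
  then show "\<forall>\<^sub>F n in sequentially. \<forall>x\<in>{1 / 2..<b}. dist (dunkl_kantorovich \<mu> \<alpha> \<beta> n f x) (f x) < e"
    using eventually_ge_at_top[of 1]
  proof eventually_elim
    case (elim n)
    show ?case
    proof
      fix x
      assume x: "x \<in> {1 / 2..<b}"
      have "\<bar>dunkl_kantorovich \<mu> \<alpha> \<beta> n f x - f x\<bar> \<le> R n"
        unfolding R_def using x elim(2) assms C
        by (intro dunkl_kantorovich_error cont) auto
      then show "dist (dunkl_kantorovich \<mu> \<alpha> \<beta> n f x) (f x) < e"
        using elim(1) by (simp add: dist_real_def)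
    qed
  qed
qed

end
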